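(* Let $q$ be a prime and let $A=A_1\oplus\cdots\oplus A_k$ be a finite abelian $q$-group, where $A_i=\mathbb{Z}_{q^{e_i}}^{n_i}$ with $1\le e_1<\cdots<e_k$ and $n_i>0$ for $1\le i\le k$. For each $1\le i\le k$, choose $\epsilon_i\in A_i\setminus qA_i$ (viewed as an element of $A$ via the inclusion of the $i$-th summand). Let $\mathcal I(e_1,\dots,e_k)$ be the set of all finite sequences of integer pairs $(i_1,f_1),\dots,(i_l,f_l)$ satisfying: (i) $l\ge 0$ (the sequence is empty when $l=0$); (ii) $1\le i_1<\cdots<i_l\le k$; (iii) $0\le f_s\le e_{i_s}-1$ for $1\le s\le l$; (iv) $0<f_{s+1}-f_s<e_{i_{s+1}}-e_{i_s}$ for $1\le s\le l-1$. Then as $(i_1,f_1),\dots,(i_l,f_l)$ runs through $\mathcal I(e_1,\dots,e_k)$, the elements $\sum_{s=1}^l q^{f_s}\epsilon_{i_s}$ form a complete list of representatives of the orbits of $A$ under the natural action of $\mathrm{Aut}(A)$, each orbit being represented exactly once.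
   Context: $\mathbb{Z}_m$ denotes the cyclic group of order $m$. The empty sum is $0$. *)

theory Defs
  imports "HOL-Algebra.Algebra"
begin

text \<open>The finite abelian q-group A = A_1 + ... + A_k with A_i = (Z_(q^(e i)))^(n i).
  An element is a function (i,j) to int, where i in {1..k} indexes the summand,
  j < n i indexes the cyclic factor, and the value lies in {0..<q^(e i)};
  all other coordinates are 0. The group operation is coordinatewise addition
  modulo q^(e i).\<close>

definition abgrp_carrier :: "nat \<Rightarrow> nat \<Rightarrow> (nat \<Rightarrow> nat) \<Rightarrow> (nat \<Rightarrow> nat) \<Rightarrow> (nat \<times> nat \<Rightarrow> int) set" where
  "abgrp_carrier q k e n =
     {x. (\<forall>i j. x (i, j) \<noteq> 0 \<longrightarrow> 1 \<le> i \<and> i \<le> k \<and> j < n i) \<and>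
         (\<forall>i j. 0 \<le> x (i, j) \<and> x (i, j) < int (q ^ e i))}"

definition abgrp :: "nat \<Rightarrow> nat \<Rightarrow> (nat \<Rightarrow> nat) \<Rightarrow> (nat \<Rightarrow> nat) \<Rightarrow> (nat \<times> nat \<Rightarrow> int) monoid" where
  "abgrp q k e n =
     \<lparr> carrier = abgrp_carrier q k e n,
       monoid.mult = (\<lambda>x y. \<lambda>(i, j). (x (i, j) + y (i, j)) mod int (q ^ e i)),
       one = (\<lambda>_. 0) \<rparr>"

definition summand :: "nat \<Rightarrow> nat \<Rightarrow> (nat \<Rightarrow> nat) \<Rightarrow> (nat \<Rightarrow> nat) \<Rightarrow> nat \<Rightarrow> (nat \<times> nat \<Rightarrow> int) set" where
  "summand q k e n i = {x \<in> abgrp_carrier q k e n. \<forall>i' j. i' \<noteq> i \<longrightarrow> x (i', j) = 0}"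

definition index_seqs :: "nat \<Rightarrow> (nat \<Rightarrow> nat) \<Rightarrow> (nat \<times> nat) list set" where
  "index_seqs k e =
     {xs. (\<forall>(i, f) \<in> set xs. 1 \<le> i \<and> i \<le> k \<and> f \<le> e i - 1) \<and>
          (\<forall>s. Suc s < length xs \<longrightarrow>
             fst (xs ! s) < fst (xs ! Suc s) \<and>
             0 < int (snd (xs ! Suc s)) - int (snd (xs ! s)) \<and>
             int (snd (xs ! Suc s)) - int (snd (xs ! s))
               < int (e (fst (xs ! Suc s))) - int (e (fst (xs ! s))))}"

fun rep_elem :: "('a, 'b) monoid_scheme \<Rightarrow> nat \<Rightarrow> (nat \<Rightarrow> 'a) \<Rightarrow> (nat \<times> nat) list \<Rightarrow> 'a" where
  "rep_elem G q eps [] = \<one>\<^bsub>G\<^esub>"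
| "rep_elem G q eps ((i, f) # xs) = (eps i [^]\<^bsub>G\<^esub> (q ^ f :: nat)) \<otimes>\<^bsub>G\<^esub> rep_elem G q eps xs"

end

theory Submission
  imports Defs
begin

text \<open>Existence. Adding to all coordinates suitable multiples of one coordinate is an automorphism,
  as long as the multiplier into a factor of exponent \<open>e'\<close> from one of exponent \<open>e\<close> is divisible by
  \<open>q ^ (e' - e)\<close>. Such shears first bring the component of an element in \<open>A\<^sub>i\<close> to the form
  \<open>q ^ f\<^sub>i \<epsilon>\<^sub>i\<close>, and then erase the component in \<open>A\<^sub>j\<close> whenever
  \<open>f\<^sub>i + max 0 (e\<^sub>j - e\<^sub>i) \<le> f\<^sub>j\<close> for some \<open>i \<noteq> j\<close>. The exponents that survive are exactly those
  of a sequence satisfying (iv).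

  Uniqueness. The relation \<open>q ^ h x \<in> q ^ t A\<close> is invariant under automorphisms. If \<open>(i, f)\<close> occurs
  in the sequence of \<open>x\<close>, then \<open>q ^ (e\<^sub>i - 1 - f) x\<close> has height exactly \<open>e\<^sub>i - 1\<close>; any other sequence
  with the same heights must therefore contain some \<open>(j, f)\<close> with \<open>j \<ge> i\<close>. By symmetry, and because
  the second entries of a sequence are distinct, \<open>j = i\<close>.\<close>

section \<open>Orbits and heights in an arbitrary group\<close>

definition orbit_rel :: "('a, 'b) monoid_scheme \<Rightarrow> 'a \<Rightarrow> 'a \<Rightarrow> bool" where
  "orbit_rel G x y \<longleftrightarrow> (\<exists>\<phi> \<in> iso G G. \<phi> x = y)"

lemma orbit_rel_refl: "orbit_rel G x x"
  unfolding orbit_rel_def by (rule bexI[of _ "\<lambda>x. x"]) (auto simp: iso_def hom_def bij_betw_def)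

lemma orbit_rel_trans: "orbit_rel G x y \<Longrightarrow> orbit_rel G y z \<Longrightarrow> orbit_rel G x z"
  unfolding orbit_rel_def by (metis comp_apply iso_set_trans)

lemma (in group) orbit_rel_sym:
  assumes "x \<in> carrier G" "orbit_rel G x y"
  shows "orbit_rel G y x"
proof -
  obtain \<phi> where \<phi>: "\<phi> \<in> iso G G" "\<phi> x = y" using assms(2) unfolding orbit_rel_def by blast
  have "inv_into (carrier G) \<phi> y = x"
    using \<phi> assms(1) by (auto simp: iso_def bij_betw_def)
  then show ?thesis unfolding orbit_rel_def using iso_set_sym[OF \<phi>(1)] by blast
qed

definition height_ge :: "('a, 'b) monoid_scheme \<Rightarrow> nat \<Rightarrow> 'a \<Rightarrow> nat \<Rightarrow> nat \<Rightarrow> bool" where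
  "height_ge G q x h t \<longleftrightarrow> (\<exists>a \<in> carrier G. x [^]\<^bsub>G\<^esub> (q ^ h) = a [^]\<^bsub>G\<^esub> (q ^ t))"

text \<open>An automorphism carries a \<open>q ^ t\<close>-th root of \<open>x [^] (q ^ h)\<close>
  to one of \<open>y [^] (q ^ h)\<close>. This invariance is what separates orbits.\<close>

lemma (in group) height_ge_orbit_rel:
  assumes "x \<in> carrier G" "orbit_rel G x y" "height_ge G q x h t"
  shows "height_ge G q y h t"
proof -
  obtain \<phi> where \<phi>: "\<phi> \<in> iso G G" "\<phi> x = y" using assms(2) unfolding orbit_rel_def by blast
  obtain a where a: "a \<in> carrier G" "x [^] (q ^ h) = a [^] (q ^ t)"
    using assms(3) unfolding height_ge_def by blast
  have hom: "\<phi> \<in> hom G G" using \<phi>(1) by (simp add: iso_def)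
  then interpret group_hom G G \<phi> by unfold_locales
  have "y [^] (q ^ h) = \<phi> a [^] (q ^ t)"
    using arg_cong[OF a(2), of \<phi>] a(1) assms(1) \<phi>(2) by (simp add: hom_nat_pow)
  then show ?thesis unfolding height_ge_def using a(1) by (intro bexI[of _ "\<phi> a"]) simp_all
qed

section \<open>The group as functions on coordinates\<close>

locale abelian_q_group =
  fixes q k :: nat and e n :: "nat \<Rightarrow> nat"
  assumes prime_q: "Factorial_Ring.prime q"
    and e_pos: "\<And>i. i \<in> {1..k} \<Longrightarrow> 1 \<le> e i"
    and e_mono: "\<And>i i'. i \<in> {1..k} \<Longrightarrow> i' \<in> {1..k} \<Longrightarrow> i < i' \<Longrightarrow> e i < e i'"
begin

abbreviation G where "G \<equiv> abgrp q k e n"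

definition coords :: "(nat \<times> nat) set" where
  "coords = {(i, j). i \<in> {1..k} \<and> j < n i}"

lemma q_pos: "0 < q" using prime_q by (simp add: prime_gt_0_nat)
lemma q_gt_1: "1 < q" using prime_q by (metis prime_gt_Suc_0_nat One_nat_def)
lemma prime_int_q: "Factorial_Ring.prime (int q)" using prime_q by simp

lemma q_power_dvd_iff: "int q ^ a dvd int q ^ b \<longleftrightarrow> a \<le> b"
  using q_gt_1 by (metis le_imp_power_dvd of_nat_dvd_iff of_nat_power power_dvd_imp_le)

lemma q_power_dvd_unit_iff:
  assumes "\<not> int q dvd u"
  shows "int q ^ a dvd int q ^ b * u \<longleftrightarrow> a \<le> b"
proof -
  have "coprime (int q ^ a) u"
    using assms prime_int_q by (simp add: prime_imp_coprime)
  then show ?thesis by (simp add: coprime_dvd_mult_left_iff q_power_dvd_iff)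
qed

lemma mem_carrier_iff:
  "x \<in> carrier G \<longleftrightarrow> (\<forall>b. b \<notin> coords \<longrightarrow> x b = 0) \<and> (\<forall>b. 0 \<le> x b \<and> x b < int q ^ e (fst b))"
  unfolding abgrp_def abgrp_carrier_def coords_def split_paired_All by auto

lemma mult_apply: "(x \<otimes>\<^bsub>G\<^esub> y) b = (x b + y b) mod int q ^ e (fst b)"
  unfolding abgrp_def by (cases b) simp

lemma one_apply: "\<one>\<^bsub>G\<^esub> b = 0"
  unfolding abgrp_def by simp

lemma carrier_mod: "x \<in> carrier G \<Longrightarrow> x b mod int q ^ e (fst b) = x b"
  unfolding mem_carrier_iff by (metis mod_pos_pos_trivial)

lemma carrier_outside: "x \<in> carrier G \<Longrightarrow> b \<notin> coords \<Longrightarrow> x b = 0"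
  unfolding mem_carrier_iff by blast

lemma carrierI_mod:
  "(\<And>b. b \<notin> coords \<Longrightarrow> x b = 0) \<Longrightarrow> (\<lambda>b. x b mod int q ^ e (fst b)) \<in> carrier G"
  using q_pos by (simp add: mem_carrier_iff)

lemma carrier_eqI:
  assumes "x \<in> carrier G" "y \<in> carrier G"
    and "\<And>b. b \<in> coords \<Longrightarrow> int q ^ e (fst b) dvd x b - y b"
  shows "x = y"
proof
  fix b show "x b = y b"
    by (metis assms carrier_mod mem_carrier_iff mod_eq_dvd_iff)
qed

lemma group_G: "group G"
proof (rule groupI)
  show "\<one>\<^bsub>G\<^esub> \<in> carrier G" using q_pos by (simp add: mem_carrier_iff one_apply)
  show "x \<otimes>\<^bsub>G\<^esub> y \<in> carrier G" if "x \<in> carrier G" "y \<in> carrier G" for x y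
    using that q_pos by (simp add: mem_carrier_iff mult_apply)
  show "x \<otimes>\<^bsub>G\<^esub> y \<otimes>\<^bsub>G\<^esub> z = x \<otimes>\<^bsub>G\<^esub> (y \<otimes>\<^bsub>G\<^esub> z)" for x y z
    by (rule ext) (simp add: mult_apply mod_simps add.assoc)
  show "\<one>\<^bsub>G\<^esub> \<otimes>\<^bsub>G\<^esub> x = x" if "x \<in> carrier G" for x
    by (rule ext) (simp add: mult_apply one_apply carrier_mod[OF that])
  show "\<exists>y \<in> carrier G. y \<otimes>\<^bsub>G\<^esub> x = \<one>\<^bsub>G\<^esub>" if x: "x \<in> carrier G" for x
  proof
    show "(\<lambda>b. (- x b) mod int q ^ e (fst b)) \<in> carrier G"
      by (rule carrierI_mod) (use x in \<open>simp add: carrier_outside\<close>)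
    show "(\<lambda>b. (- x b) mod int q ^ e (fst b)) \<otimes>\<^bsub>G\<^esub> x = \<one>\<^bsub>G\<^esub>"
      by (rule ext) (simp add: mult_apply one_apply mod_simps)
  qed
qed

sublocale group G by (rule group_G)

lemma pow_apply: "x \<in> carrier G \<Longrightarrow> (x [^]\<^bsub>G\<^esub> (m::nat)) b = int m * x b mod int q ^ e (fst b)"
proof (induction m)
  case (Suc m)
  then show ?case by (simp add: mult_apply mod_simps distrib_right add.commute)
qed (simp add: one_apply)

text \<open>Finiteness later turns an injective endomorphism into an automorphism.\<close>

lemma finite_carrier: "finite (carrier G)"
proof (rule finite_subset)
  have "finite coords"
    by (rule finite_subset[of _ "Sigma {1..k} (\<lambda>i. {..<n i})"]) (auto simp: coords_def)
  moreover define N where "N = Max ((\<lambda>b. int q ^ e (fst b)) ` coords)"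
  ultimately show "finite {x. \<forall>b. (b \<in> coords \<longrightarrow> x b \<in> {0..N}) \<and> (b \<notin> coords \<longrightarrow> x b = 0)}"
    by (intro finite_set_of_finite_funs) auto
  have "int q ^ e (fst b) \<le> N" if "b \<in> coords" for b
    unfolding N_def using \<open>finite coords\<close> that by (intro Max_ge) auto
  then show "carrier G \<subseteq> {x. \<forall>b. (b \<in> coords \<longrightarrow> x b \<in> {0..N}) \<and> (b \<notin> coords \<longrightarrow> x b = 0)}"
    by (fastforce simp: mem_carrier_iff dest: order.strict_implies_order order.trans)
qed

section \<open>Shear automorphisms\<close>

text \<open>The map multiplies coordinate \<open>a\<close> by \<open>c a\<close> and adds
  \<open>c b\<close> times the old coordinate \<open>a\<close> to every other coordinate
  \<open>b\<close>. The divisibility assumption on \<open>c\<close> makes this additive despite the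
  different moduli; \<open>c a\<close> is a unit, so the map is injective.\<close>

lemma orbit_rel_shear:
  assumes x: "x \<in> carrier G" and y: "y \<in> carrier G" and a: "a \<in> coords"
    and c: "\<And>b. b \<in> coords \<Longrightarrow> int q ^ e (fst b) dvd c b * int q ^ e (fst a)"
    and ca: "\<not> int q dvd c a"
    and ya: "int q ^ e (fst a) dvd y a - c a * x a"
    and yb: "\<And>b. b \<in> coords \<Longrightarrow> b \<noteq> a \<Longrightarrow> int q ^ e (fst b) dvd y b - (x b + c b * x a)"
  shows "orbit_rel G x y"
proof -
  define \<phi> where "\<phi> z b = (if b \<in> coords
      then ((if b = a then 0 else z b) + c b * z a) mod int q ^ e (fst b) else 0)" for z b
  have in_carrier: "\<phi> z \<in> carrier G" for z
    using q_pos by (auto simp: mem_carrier_iff \<phi>_def)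
  have "\<phi> (z \<otimes>\<^bsub>G\<^esub> w) = \<phi> z \<otimes>\<^bsub>G\<^esub> \<phi> w" for z w
  proof (rule carrier_eqI)
    fix b assume b: "b \<in> coords"
    let ?m = "int q ^ e (fst b)"
    have "?m dvd c b * ((z a + w a) mod int q ^ e (fst a)) - c b * (z a + w a)"
    proof -
      \<comment> \<open>Reducing coordinate \<open>a\<close> shifts it by a multiple of
        \<open>q ^ e (fst a)\<close>, which \<open>c b\<close> turns into a multiple of
        \<open>q ^ e (fst b)\<close>.\<close>
      have "c b * int q ^ e (fst a) dvd c b * ((z a + w a) mod int q ^ e (fst a) - (z a + w a))"
        by (intro mult_dvd_mono) (auto simp flip: mod_eq_dvd_iff)
      then show ?thesis using c[OF b] by (metis dvd_trans right_diff_distrib)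
    qed
    then have c_mod: "c b * ((z a + w a) mod int q ^ e (fst a)) mod ?m = c b * (z a + w a) mod ?m"
      by (simp add: mod_eq_dvd_iff)
    then have "(((z b + w b) mod ?m) + c b * ((z a + w a) mod int q ^ e (fst a))) mod ?m
        = ((z b + w b) + c b * (z a + w a)) mod ?m"
      by (metis mod_add_eq mod_mod_trivial)
    also have "\<dots> = ((z b + c b * z a) mod ?m + (w b + c b * w a) mod ?m) mod ?m"
      unfolding mod_add_eq by (simp add: algebra_simps)
    finally have sum_mod: "(((z b + w b) mod ?m) + c b * ((z a + w a) mod int q ^ e (fst a))) mod ?m
        = ((z b + c b * z a) mod ?m + (w b + c b * w a) mod ?m) mod ?m" .
    have "\<phi> (z \<otimes>\<^bsub>G\<^esub> w) b = (\<phi> z \<otimes>\<^bsub>G\<^esub> \<phi> w) b"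
      using b c_mod sum_mod
      by (cases "b = a") (simp_all add: \<phi>_def mult_apply distrib_left mod_add_eq)
    then show "?m dvd \<phi> (z \<otimes>\<^bsub>G\<^esub> w) b - (\<phi> z \<otimes>\<^bsub>G\<^esub> \<phi> w) b" by simp
  qed (use in_carrier in auto)
  then have hom: "\<phi> \<in> hom G G" using in_carrier by (auto simp: hom_def)
  have inj: "inj_on \<phi> (carrier G)"
  proof (rule inj_onI)
    fix z w assume z: "z \<in> carrier G" and w: "w \<in> carrier G" and eq: "\<phi> z = \<phi> w"
    have "int q ^ e (fst a) dvd c a * (z a - w a)"
      using fun_cong[OF eq, of a] a by (simp add: \<phi>_def mod_eq_dvd_iff algebra_simps)
    moreover have "coprime (int q ^ e (fst a)) (c a)"
      using ca prime_int_q by (simp add: prime_imp_coprime)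
    ultimately have "int q ^ e (fst a) dvd z a - w a"
      by (simp add: coprime_dvd_mult_right_iff)
    then have za: "z a = w a" using carrier_mod[OF z, of a] carrier_mod[OF w, of a]
      by (simp flip: mod_eq_dvd_iff)
    show "z = w"
    proof (rule carrier_eqI[OF z w])
      fix b assume "b \<in> coords"
      then show "int q ^ e (fst b) dvd z b - w b"
        using fun_cong[OF eq, of b] za by (cases "b = a") (auto simp: \<phi>_def mod_eq_dvd_iff)
    qed
  qed
  have "\<phi> ` carrier G = carrier G"
    using in_carrier by (intro endo_inj_surj[OF finite_carrier _ inj]) auto
  then have "\<phi> \<in> iso G G" using hom inj by (simp add: iso_def bij_betw_def)
  moreover have "\<phi> x = y"
  proof (rule carrier_eqI[OF in_carrier y])
    fix b assume "b \<in> coords"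
    then show "int q ^ e (fst b) dvd \<phi> x b - y b"
      using ya yb[of b] by (auto simp: \<phi>_def simp flip: mod_eq_dvd_iff)
  qed
  ultimately show ?thesis unfolding orbit_rel_def by blast
qed

lemma inverse_mod_q_power:
  assumes "\<not> int q dvd u"
  obtains w where "int q ^ m dvd u * w - 1" "\<not> int q dvd w"
proof -
  have "coprime (int q) u"
    using assms prime_int_q by (rule prime_imp_coprime[rotated])
  \<comment> \<open>The exponent \<open>Suc m\<close> instead of \<open>m\<close> makes q divide
    \<open>u * w - 1\<close> even for \<open>m = 0\<close>, which forces \<open>w\<close> to be
    prime to q.\<close>
  then have "coprime u (int q ^ Suc m)"
    by (simp add: coprime_commute)
  then obtain w v where "w * u + v * int q ^ Suc m = 1"
    using bezout_int[of u "int q ^ Suc m"] by auto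
  then have "u * w - 1 = int q ^ Suc m * (- v)" by (simp add: algebra_simps)
  then have "int q ^ Suc m dvd u * w - 1" by (rule dvdI)
  then have "int q ^ m dvd u * w - 1" and q1: "int q dvd u * w - 1"
    by (auto dest: dvd_mult_right dvd_mult_left)
  moreover have "\<not> int q dvd w"
  proof
    assume "int q dvd w"
    then have "int q dvd u * w - (u * w - 1)" by (rule dvd_diff[OF dvd_mult q1])
    then show False using q_gt_1 by simp
  qed
  ultimately show thesis using that by blast
qed

text \<open>Coordinate \<open>a\<close> serves as pivot: up to the modulus, its admissible multiples
  in coordinate \<open>b\<close> are exactly the multiples of
  \<open>q ^ (v + (e (fst b) - e (fst a)))\<close>. One shear makes all these changes and replaces
  the unit part at the pivot.\<close>

lemma orbit_rel_change:
  assumes x: "x \<in> carrier G" and y: "y \<in> carrier G" and a: "a \<in> coords"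
    and xa: "x a = int q ^ v * u" "\<not> int q dvd u"
    and ya: "y a = int q ^ v * u'" "\<not> int q dvd u'"
    and diff: "\<And>b. b \<in> coords \<Longrightarrow> b \<noteq> a \<Longrightarrow>
      int q ^ (v + (e (fst b) - e (fst a))) dvd y b - x b"
  shows "orbit_rel G x y"
proof -
  define d where "d b = (y b - x b) div int q ^ (v + (e (fst b) - e (fst a)))" for b
  have d: "y b - x b = int q ^ (v + (e (fst b) - e (fst a))) * d b" if "b \<in> coords" "b \<noteq> a" for b
    using diff[OF that] by (simp add: d_def)
  have "\<exists>w. int q ^ m dvd u * w - 1 \<and> \<not> int q dvd w" for m
    using inverse_mod_q_power[OF xa(2)] by metis
  then obtain w where w: "\<And>m. int q ^ m dvd u * w m - 1" "\<And>m. \<not> int q dvd w m" by metis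
  \<comment> \<open>As \<open>w m\<close> inverts \<open>u\<close> modulo \<open>q ^ m\<close>,
    \<open>c b * x a\<close> is congruent to \<open>y b - x b\<close>, and \<open>c a\<close> turns
    \<open>u\<close> into \<open>u'\<close>. The power of q makes the shear well defined.\<close>
  define c where "c b = (if b = a then u' * w (e (fst a))
      else int q ^ (e (fst b) - e (fst a)) * d b * w (e (fst b)))" for b
  show ?thesis
  proof (rule orbit_rel_shear[OF x y a, of c])
    show "int q ^ e (fst b) dvd c b * int q ^ e (fst a)" for b
    proof (cases "b = a")
      case False
      have "int q ^ e (fst b) dvd int q ^ (e (fst b) - e (fst a)) * int q ^ e (fst a)"
        by (simp add: q_power_dvd_iff flip: power_add)
      then have "int q ^ e (fst b) dvd int q ^ (e (fst b) - e (fst a)) * int q ^ e (fst a) * (d b * w (e (fst b)))"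
        by (rule dvd_mult2)
      then show ?thesis using False by (simp add: c_def mult_ac)
    qed simp
    show "\<not> int q dvd c a"
      using ya(2) w(2) by (simp add: c_def prime_dvd_mult_iff[OF prime_int_q])
    have "y a - c a * x a = - (int q ^ v * u') * (u * w (e (fst a)) - 1)"
      by (simp add: c_def xa ya algebra_simps)
    then show "int q ^ e (fst a) dvd y a - c a * x a" using w(1) by (metis dvd_mult)
    fix b assume b: "b \<in> coords" "b \<noteq> a"
    have "y b - (x b + c b * x a) = (y b - x b) - c b * x a" by simp
    also have "\<dots> = - (int q ^ (v + (e (fst b) - e (fst a))) * d b) * (u * w (e (fst b)) - 1)"
      using b by (simp add: d c_def xa power_add algebra_simps)
    finally show "int q ^ e (fst b) dvd y b - (x b + c b * x a)" using w(1) by (metis dvd_mult)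
  qed
qed

section \<open>Heights in coordinates\<close>

text \<open>Modulo \<open>q ^ e\<close> the multiples of \<open>q ^ t\<close> are those of
  \<open>q ^ min t e\<close>, so a root can be sought one coordinate at a time.\<close>

lemma height_ge_iff:
  assumes x: "x \<in> carrier G"
  shows "height_ge G q x h t \<longleftrightarrow>
    (\<forall>b \<in> coords. int q ^ min t (e (fst b)) dvd int q ^ h * x b)"
proof
  assume "height_ge G q x h t"
  then obtain a where a: "a \<in> carrier G" "x [^]\<^bsub>G\<^esub> (q ^ h) = a [^]\<^bsub>G\<^esub> (q ^ t)"
    unfolding height_ge_def by blast
  show "\<forall>b \<in> coords. int q ^ min t (e (fst b)) dvd int q ^ h * x b"
  proof
    fix b
    have "int q ^ e (fst b) dvd int q ^ h * x b - int q ^ t * a b"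
      using fun_cong[OF a(2), of b] a(1) x by (simp add: pow_apply mod_eq_dvd_iff)
    then have "int q ^ min t (e (fst b)) dvd int q ^ h * x b - int q ^ t * a b"
      by (rule dvd_trans[rotated]) (simp add: q_power_dvd_iff)
    moreover have "int q ^ min t (e (fst b)) dvd int q ^ t * a b"
      by (rule dvd_mult2) (simp add: q_power_dvd_iff)
    ultimately show "int q ^ min t (e (fst b)) dvd int q ^ h * x b"
      by (metis dvd_add diff_add_cancel)
  qed
next
  assume *: "\<forall>b \<in> coords. int q ^ min t (e (fst b)) dvd int q ^ h * x b"
  \<comment> \<open>For \<open>t > e (fst b)\<close> the hypothesis makes \<open>q ^ h * x b\<close>
    vanish modulo \<open>q ^ e (fst b)\<close>, so 0 is a root there.\<close>
  define c where "c b = (if t \<le> e (fst b) then int q ^ h * x b div int q ^ t else 0)" for b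
  define a where "a b = c b mod int q ^ e (fst b)" for b
  have a: "a \<in> carrier G" unfolding a_def
    by (rule carrierI_mod) (use x in \<open>simp add: carrier_outside c_def\<close>)
  have "x [^]\<^bsub>G\<^esub> (q ^ h) = a [^]\<^bsub>G\<^esub> (q ^ t)"
  proof (rule carrier_eqI)
    fix b assume b: "b \<in> coords"
    have "int q ^ h * x b mod int q ^ e (fst b) = int q ^ t * c b mod int q ^ e (fst b)"
      using *[rule_format, OF b] by (auto simp: c_def min_def split: if_splits)
    then have "(x [^]\<^bsub>G\<^esub> (q ^ h)) b = (a [^]\<^bsub>G\<^esub> (q ^ t)) b"
      using x a by (simp add: pow_apply a_def mod_simps)
    then show "int q ^ e (fst b) dvd (x [^]\<^bsub>G\<^esub> (q ^ h)) b - (a [^]\<^bsub>G\<^esub> (q ^ t)) b" by simp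
  qed (use x a in auto)
  then show "height_ge G q x h t" unfolding height_ge_def using a by blast
qed

end

section \<open>The chosen elements and their multiples\<close>

locale based_abelian_q_group = abelian_q_group +
  fixes eps :: "nat \<Rightarrow> (nat \<times> nat \<Rightarrow> int)"
  assumes eps_summand: "\<And>i. i \<in> {1..k} \<Longrightarrow> eps i \<in> summand q k e n i"
    and eps_not_pow: "\<And>i a. i \<in> {1..k} \<Longrightarrow> a \<in> summand q k e n i \<Longrightarrow>
      eps i \<noteq> a [^]\<^bsub>abgrp q k e n\<^esub> q"
begin

lemma summand_iff: "x \<in> summand q k e n i \<longleftrightarrow> x \<in> carrier G \<and> (\<forall>b. fst b \<noteq> i \<longrightarrow> x b = 0)"
  unfolding summand_def abgrp_def by auto

lemma eps_carrier: "i \<in> {1..k} \<Longrightarrow> eps i \<in> carrier G"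
  using eps_summand summand_iff by blast

lemma eps_outside: "i \<in> {1..k} \<Longrightarrow> fst b \<noteq> i \<Longrightarrow> eps i b = 0"
  using eps_summand summand_iff by blast

text \<open>If q divided every coordinate of \<open>eps i\<close>, the coordinatewise quotient would
  be a q-th root of \<open>eps i\<close> in the same summand.\<close>

lemma eps_unit_coord:
  assumes i: "i \<in> {1..k}"
  obtains b where "b \<in> coords" "fst b = i" "\<not> int q dvd eps i b"
proof (rule ccontr)
  assume "\<not> thesis"
  then have dvd: "int q dvd eps i b" for b
    using that eps_outside[OF i, of b] carrier_outside[OF eps_carrier[OF i], of b]
    by (metis dvd_0_right)
  define a where "a b = eps i b div int q" for b
  have "0 \<le> a b \<and> a b < int q ^ e (fst b)" for b
  proof -
    have eps: "0 \<le> eps i b" "eps i b < int q ^ e (fst b)"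
      using eps_carrier[OF i] unfolding mem_carrier_iff by blast+
    have a0: "0 \<le> a b" using eps(1) q_pos by (simp add: a_def pos_imp_zdiv_nonneg_iff)
    then have "1 * a b \<le> int q * a b" using q_pos by (intro mult_right_mono) auto
    also have "int q * a b = eps i b" using dvd by (simp add: a_def)
    finally show ?thesis using a0 eps by simp
  qed
  then have a: "a \<in> carrier G"
    using carrier_outside[OF eps_carrier[OF i]] unfolding mem_carrier_iff by (simp add: a_def)
  have "(a [^]\<^bsub>G\<^esub> q) b = eps i b" for b
    using dvd carrier_mod[OF eps_carrier[OF i]] by (simp add: pow_apply[OF a]) (simp add: a_def)
  then have "eps i = a [^]\<^bsub>G\<^esub> q" by auto
  moreover have "a \<in> summand q k e n i"
    using a eps_outside[OF i] by (simp add: summand_iff a_def del: split_paired_All)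
  ultimately show False using eps_not_pow[OF i] by blast
qed

text \<open>The value \<open>f i = e i\<close> encodes a vanishing component in the \<open>i\<close>-th summand.\<close>

definition std_elem :: "(nat \<Rightarrow> nat) \<Rightarrow> nat \<times> nat \<Rightarrow> int" where
  "std_elem f b = (if b \<in> coords
     then int q ^ f (fst b) * eps (fst b) b mod int q ^ e (fst b) else 0)"

lemma std_elem_carrier: "std_elem f \<in> carrier G"
  using q_pos unfolding mem_carrier_iff by (simp add: std_elem_def)

lemma fst_coords: "b \<in> coords \<Longrightarrow> fst b \<in> {1..k}"
  by (auto simp: coords_def)

text \<open>At a coordinate of \<open>eps i\<close> prime to q, divisibility is decided by the
  exponent alone. Reduction modulo \<open>q ^ e i\<close> is harmless because only powers up to
  \<open>q ^ e i\<close> are tested.\<close>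

lemma height_ge_std_elem:
  "height_ge G q (std_elem f) h t \<longleftrightarrow> (\<forall>i \<in> {1..k}. min t (e i) \<le> f i + h)"
proof -
  have *: "int q ^ min t (e (fst b)) dvd int q ^ h * std_elem f b \<longleftrightarrow>
      int q ^ min t (e (fst b)) dvd int q ^ (f (fst b) + h) * eps (fst b) b" if "b \<in> coords" for b
  proof -
    have d: "int q ^ min t (e (fst b)) dvd int q ^ e (fst b)" by (simp add: q_power_dvd_iff)
    have "int q ^ h * std_elem f b mod int q ^ e (fst b)
        = int q ^ (f (fst b) + h) * eps (fst b) b mod int q ^ e (fst b)"
      using that by (simp add: std_elem_def mod_mult_right_eq power_add mult_ac)
    then show ?thesis by (metis d dvd_mod_iff)
  qed
  show ?thesis
    unfolding height_ge_iff[OF std_elem_carrier]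
  proof
    assume L: "\<forall>b \<in> coords. int q ^ min t (e (fst b)) dvd int q ^ h * std_elem f b"
    show "\<forall>i \<in> {1..k}. min t (e i) \<le> f i + h"
    proof
      fix i assume "i \<in> {1..k}"
      then obtain b where "b \<in> coords" "fst b = i" "\<not> int q dvd eps i b" by (rule eps_unit_coord)
      then show "min t (e i) \<le> f i + h" using L * q_power_dvd_unit_iff by blast
    qed
  next
    assume R: "\<forall>i \<in> {1..k}. min t (e i) \<le> f i + h"
    show "\<forall>b \<in> coords. int q ^ min t (e (fst b)) dvd int q ^ h * std_elem f b"
    proof
      fix b assume b: "b \<in> coords"
      have "int q ^ min t (e (fst b)) dvd int q ^ (f (fst b) + h) * eps (fst b) b"
        using R fst_coords[OF b] by (intro dvd_mult2) (simp add: q_power_dvd_iff)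
      then show "int q ^ min t (e (fst b)) dvd int q ^ h * std_elem f b" using *[OF b] by simp
    qed
  qed
qed

lemma mod_q_power_unit:
  assumes "\<not> int q dvd u" "f < m"
  obtains u' where "int q ^ f * u mod int q ^ m = int q ^ f * u'" "\<not> int q dvd u'"
proof (rule that)
  have "int q ^ m = int q ^ f * int q ^ (m - f)" using assms(2) by (simp flip: power_add)
  then show "int q ^ f * u mod int q ^ m = int q ^ f * (u mod int q ^ (m - f))"
    by (metis mult_mod_right)
  have "int q dvd int q ^ (m - f)" using assms(2) by (intro dvd_power) auto
  then show "\<not> int q dvd u mod int q ^ (m - f)" using assms(1) by (simp add: dvd_mod_iff)
qed

section \<open>Reaching standard form\<close>

text \<open>A coordinate of least valuation \<open>v\<close> in the block is the first pivot. It
  transfers valuation \<open>v\<close> to a position where \<open>eps i\<close> is prime to q; with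
  that position as second pivot the whole block becomes \<open>q ^ v * eps i\<close>.\<close>

lemma orbit_rel_normalise_block:
  assumes x: "x \<in> carrier G" and i: "i \<in> {1..k}"
  obtains y f where "y \<in> carrier G" "orbit_rel G x y" "f \<le> e i"
    "\<And>b. b \<in> coords \<Longrightarrow> y b = (if fst b = i then int q ^ f * eps i b mod int q ^ e i else x b)"
proof (cases "\<forall>b \<in> coords. fst b = i \<longrightarrow> x b = 0")
  case True
  show ?thesis by (rule that[of x "e i"]) (use x True orbit_rel_refl in auto)
next
  case False
  define P where "P b \<longleftrightarrow> b \<in> coords \<and> fst b = i \<and> x b \<noteq> 0" for b
  obtain a where a: "P a" and a_min: "\<And>b. P b \<Longrightarrow> multiplicity (int q) (x a) \<le> multiplicity (int q) (x b)"
    using False ex_has_least_nat[of P _ "\<lambda>b. multiplicity (int q) (x b)"] unfolding P_def by blast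
  define v where "v = multiplicity (int q) (x a)"
  have a': "a \<in> coords" "fst a = i" "x a \<noteq> 0" using a by (auto simp: P_def)
  have "\<not> is_unit (int q)" using q_gt_1 by simp
  then obtain u where u: "x a = int q ^ v * u" "\<not> int q dvd u"
    using multiplicity_decompose'[of "x a" "int q"] a'(3) unfolding v_def by blast
  have dvd: "int q ^ v dvd x b" if "b \<in> coords" "fst b = i" for b
    using a_min[of b] that by (cases "x b = 0") (auto simp: P_def v_def multiplicity_dvd')
  have v: "v < e i"
  proof (rule ccontr)
    assume "\<not> v < e i"
    then have "int q ^ e i dvd x a" unfolding u by (intro dvd_mult2) (simp add: q_power_dvd_iff)
    then show False using carrier_mod[OF x, of a] a' by auto
  qed
  obtain a1 where a1: "a1 \<in> coords" "fst a1 = i" "\<not> int q dvd eps i a1"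
    using i by (rule eps_unit_coord)
  obtain x1 u1 where x1: "x1 \<in> carrier G" "orbit_rel G x x1" "x1 a1 = int q ^ v * u1" "\<not> int q dvd u1"
    and x1_eq: "\<And>b. b \<noteq> a1 \<Longrightarrow> x1 b = x b"
  proof (cases "a1 = a")
    case True
    then show thesis using that[of x u] x u orbit_rel_refl[of G x] by simp
  next
    case False
    \<comment> \<open>By minimality of \<open>v\<close> the old value at \<open>a1\<close> is a
      multiple of \<open>q ^ v\<close>, so this overwriting is a permitted change;
      \<open>v < e i\<close> keeps the new value in range.\<close>
    define x1 where "x1 = x(a1 := int q ^ v)"
    have carr: "x1 \<in> carrier G"
      using x a1 v q_gt_1 unfolding mem_carrier_iff x1_def
      by (auto simp del: split_paired_All)
    have "orbit_rel G x x1"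
    proof (rule orbit_rel_change[OF x carr a'(1) u])
      show "x1 a = int q ^ v * u" using False u by (simp add: x1_def)
      fix b assume b: "b \<in> coords" "b \<noteq> a"
      show "int q ^ (v + (e (fst b) - e (fst a))) dvd x1 b - x b"
        using dvd[OF a1(1,2)] a1 a' by (cases "b = a1") (auto simp: x1_def)
    qed (rule u(2))
    then show thesis using that[of x1 1] carr q_gt_1 by (simp add: x1_def)
  qed
  define y where "y b = (if b \<in> coords \<and> fst b = i then int q ^ v * eps i b mod int q ^ e i else x b)" for b
  have y: "y \<in> carrier G"
    using x q_pos unfolding mem_carrier_iff y_def by (auto simp del: split_paired_All)
  obtain u2 where u2: "int q ^ v * eps i a1 mod int q ^ e i = int q ^ v * u2" "\<not> int q dvd u2"
    using mod_q_power_unit[OF a1(3) v] .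
  have "orbit_rel G x1 y"
  proof (rule orbit_rel_change[OF x1(1) y a1(1) x1(3,4)])
    show "y a1 = int q ^ v * u2" using a1 u2 by (simp add: y_def)
    fix b assume b: "b \<in> coords" "b \<noteq> a1"
    show "int q ^ (v + (e (fst b) - e (fst a1))) dvd y b - x1 b"
    proof (cases "fst b = i")
      case True
      have "int q ^ v dvd int q ^ e i" using v by (simp add: q_power_dvd_iff)
      then have "int q ^ v dvd int q ^ v * eps i b mod int q ^ e i" by (simp add: dvd_mod_iff)
      then show ?thesis using True b a1 dvd[OF b(1)] by (simp add: y_def x1_eq)
    qed (use b in \<open>simp add: y_def x1_eq\<close>)
  qed (rule u2(2))
  then show ?thesis
    using that[of y v] y v orbit_rel_trans[OF x1(2)] by (simp add: y_def)
qed

text \<open>Normalising one block leaves the others alone, so the blocks can be treated in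
  turn.\<close>

lemma orbit_rel_std_elem:
  assumes x: "x \<in> carrier G"
  obtains f where "\<And>i. i \<in> {1..k} \<Longrightarrow> f i \<le> e i" "orbit_rel G x (std_elem f)"
proof -
  have "\<exists>y f. y \<in> carrier G \<and> orbit_rel G x y \<and> (\<forall>i \<in> {1..m}. f i \<le> e i) \<and>
      (\<forall>b \<in> coords. fst b \<le> m \<longrightarrow> y b = std_elem f b)" if "m \<le> k" for m
    using that
  proof (induction m)
    case 0
    then show ?case
      using x orbit_rel_refl[of G x] fst_coords by (intro exI[of _ x] exI[of _ e]) force
  next
    case (Suc m)
    then obtain y f where y: "y \<in> carrier G" "orbit_rel G x y"
      and f: "\<And>i. i \<in> {1..m} \<Longrightarrow> f i \<le> e i"
      and yf: "\<And>b. b \<in> coords \<Longrightarrow> fst b \<le> m \<Longrightarrow> y b = std_elem f b"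
      by (meson Suc_leD)
    have "Suc m \<in> {1..k}" using Suc.prems by simp
    then obtain z g where z: "z \<in> carrier G" "orbit_rel G y z" "g \<le> e (Suc m)"
      and zg: "\<And>b. b \<in> coords \<Longrightarrow> z b =
        (if fst b = Suc m then int q ^ g * eps (Suc m) b mod int q ^ e (Suc m) else y b)"
      using orbit_rel_normalise_block[OF y(1)] by metis
    have "z b = std_elem (f(Suc m := g)) b" if "b \<in> coords" "fst b \<le> Suc m" for b
      using that yf[of b] zg[of b] by (cases "fst b = Suc m") (simp_all add: std_elem_def)
    moreover have "\<forall>i \<in> {1..Suc m}. (f(Suc m := g)) i \<le> e i"
      using f z(3) by auto
    ultimately show ?case
      using z(1) orbit_rel_trans[OF y(2) z(2)]
      by (intro exI[of _ z] exI[of _ "f(Suc m := g)"]) (simp del: fun_upd_apply)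
  qed
  from this[OF order_refl] obtain y f where y: "y \<in> carrier G" "orbit_rel G x y"
    and f: "\<And>i. i \<in> {1..k} \<Longrightarrow> f i \<le> e i"
    and yf: "\<And>b. b \<in> coords \<Longrightarrow> fst b \<le> k \<Longrightarrow> y b = std_elem f b" by blast
  have "y = std_elem f"
    by (rule carrier_eqI[OF y(1) std_elem_carrier]) (use yf fst_coords in auto)
  then show thesis using that[OF f] y(2) by simp
qed

section \<open>Reduced exponent functions\<close>

text \<open>Truncated subtraction makes the single inequality express both halves of (iv): the
  case \<open>i < j\<close> is \<open>f j - f i < e j - e i\<close>, and the case \<open>i > j\<close> is \<open>f j < f i\<close>.\<close>

definition reduced :: "(nat \<Rightarrow> nat) \<Rightarrow> bool" where
  "reduced f \<longleftrightarrow> (\<forall>i \<in> {1..k}. f i \<le> e i) \<and>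
     (\<forall>i \<in> {1..k}. \<forall>j \<in> {1..k}. i \<noteq> j \<longrightarrow> f i < e i \<longrightarrow> f j < e j \<longrightarrow> f j < f i + (e j - e i))"

lemma reduced_le_e: "reduced f \<Longrightarrow> i \<in> {1..k} \<Longrightarrow> f i \<le> e i"
  unfolding reduced_def by blast

lemma reduced_less:
  assumes "reduced f" "i \<in> {1..k}" "j \<in> {1..k}" "i \<noteq> j" "f i < e i" "f j < e j"
  shows "f j < f i + (e j - e i)"
  using assms unfolding reduced_def by simp

text \<open>A violated inequality says that component \<open>i\<close>, as pivot, can erase
  component \<open>j\<close>. The number of nonzero components drops, so the process ends.\<close>

lemma orbit_rel_reduced:
  assumes "\<And>i. i \<in> {1..k} \<Longrightarrow> f i \<le> e i"
  shows "\<exists>g. reduced g \<and> orbit_rel G (std_elem f) (std_elem g)"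
  using assms
proof (induction "card {i \<in> {1..k}. f i < e i}" arbitrary: f rule: less_induct)
  case less
  show ?case
  proof (cases "reduced f")
    case True
    then show ?thesis by (intro exI[of _ f]) (simp add: orbit_rel_refl)
  next
    case False
    then obtain i j where ij: "i \<in> {1..k}" "j \<in> {1..k}" "i \<noteq> j" "f i < e i" "f j < e j"
      "f i + (e j - e i) \<le> f j"
      using less.prems unfolding reduced_def by (meson not_less)
    define g where "g = f(j := e j)"
    have "{l \<in> {1..k}. g l < e l} \<subset> {l \<in> {1..k}. f l < e l}"
      using ij by (auto simp: g_def)
    then have "card {l \<in> {1..k}. g l < e l} < card {l \<in> {1..k}. f l < e l}"
      by (intro psubset_card_mono) auto
    moreover have "g l \<le> e l" if "l \<in> {1..k}" for l
      using less.prems[OF that] by (simp add: g_def)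
    ultimately obtain g' where g': "reduced g'" "orbit_rel G (std_elem g) (std_elem g')"
      using less.hyps[of g] by blast
    obtain a where a: "a \<in> coords" "fst a = i" "\<not> int q dvd eps i a"
      using ij(1) by (rule eps_unit_coord)
    obtain u where u: "int q ^ f i * eps i a mod int q ^ e i = int q ^ f i * u" "\<not> int q dvd u"
      using mod_q_power_unit[OF a(3) ij(4)] .
    have "orbit_rel G (std_elem f) (std_elem g)"
    proof (rule orbit_rel_change[OF std_elem_carrier std_elem_carrier a(1)])
      show "std_elem f a = int q ^ f i * u" "std_elem g a = int q ^ f i * u"
        using a u ij(3) by (auto simp: std_elem_def g_def)
      fix b assume b: "b \<in> coords" "b \<noteq> a"
      show "int q ^ (f i + (e (fst b) - e (fst a))) dvd std_elem g b - std_elem f b"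
      proof (cases "fst b = j")
        case True
        have "int q ^ f j dvd int q ^ f j * eps j b mod int q ^ e j"
          using ij(5) by (simp add: dvd_mod_iff q_power_dvd_iff)
        then have "int q ^ (f i + (e j - e i)) dvd int q ^ f j * eps j b mod int q ^ e j"
          using ij(6) q_power_dvd_iff dvd_trans by blast
        then show ?thesis using True b a by (simp add: std_elem_def g_def)
      qed (simp add: std_elem_def g_def)
    qed (use u in auto)
    then show ?thesis using g'(1) orbit_rel_trans[OF _ g'(2)] by (intro exI[of _ g']) simp
  qed
qed

section \<open>Recovering exponents from heights\<close>

lemma reduced_height_witness:
  assumes f: "reduced f" and i: "i \<in> {1..k}" "f i < e i"
    and eq: "\<And>h t. height_ge G q (std_elem f) h t \<longleftrightarrow> height_ge G q (std_elem g) h t"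
  obtains j where "j \<in> {1..k}" "i \<le> j" "g j = f i" "g j < e j"
proof -
  \<comment> \<open>This \<open>h\<close> raises the exponent \<open>f i\<close> to
    \<open>e i - 1\<close>, the last one with a nonzero component.\<close>
  define h where "h = e i - 1 - f i"
  have "height_ge G q (std_elem f) h (e i - 1)"
    unfolding height_ge_std_elem
  proof
    fix j assume j: "j \<in> {1..k}"
    consider "j = i" | "e j \<le> f j" | "j \<noteq> i" "f j < e j" by linarith
    then show "min (e i - 1) (e j) \<le> f j + h"
    proof cases
      case 3
      \<comment> \<open>For \<open>e j < e i\<close> the first inequality gives
        \<open>e j \<le> f j + h\<close>; otherwise it reads \<open>f i < f j\<close>, hence
        \<open>e i \<le> f j + h\<close>.\<close>
      then have "f i < f j + (e i - e j)" "f j < f i + (e j - e i)"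
        using reduced_less[OF f, of i j] reduced_less[OF f, of j i] i j by simp_all
      then show ?thesis using i by (auto simp: h_def min_def)
    qed (use i in \<open>auto simp: h_def\<close>)
  qed
  moreover have "\<not> height_ge G q (std_elem f) h (e i)"
    unfolding height_ge_std_elem using i by (auto simp: h_def intro!: bexI[of _ i])
  ultimately have hg: "height_ge G q (std_elem g) h (e i - 1)" "\<not> height_ge G q (std_elem g) h (e i)"
    using eq by auto
  then obtain j where j: "j \<in> {1..k}" "g j + h < min (e i) (e j)"
    unfolding height_ge_std_elem by (auto simp: not_le)
  moreover have "min (e i - 1) (e j) \<le> g j + h" using hg(1) j(1) height_ge_std_elem by blast
  \<comment> \<open>The two bounds are incompatible for \<open>e j < e i\<close>, where both minima
    equal \<open>e j\<close>. Hence \<open>g j + h = e i - 1\<close>.\<close>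
  ultimately have "g j = f i" "e i \<le> e j" "g j < e j" using i by (auto simp: h_def)
  moreover have "i \<le> j" using \<open>e i \<le> e j\<close> e_mono[OF j(1) i(1)] by (meson not_le)
  ultimately show thesis using that j(1) by blast
qed

text \<open>For distinct indices with equal exponents, the two inequalities would demand both
  \<open>e i < e j\<close> and \<open>e j < e i\<close>.\<close>

lemma reduced_inj:
  assumes f: "reduced f" and i: "i \<in> {1..k}" "j \<in> {1..k}" "f i = f j" "f i < e i" "f j < e j"
  shows "i = j"
proof (rule ccontr)
  assume "i \<noteq> j"
  then have "f j < f i + (e j - e i)" "f i < f j + (e i - e j)" using reduced_less[OF f, of i j] reduced_less[OF f, of j i] i by simp_all
  then show False using i by auto
qed

text \<open>Passing from \<open>f\<close> to \<open>g\<close> and back yields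
  \<open>i \<le> j \<le> l\<close> with \<open>f l = f i\<close>; injectivity gives
  \<open>l = i\<close>, so \<open>j = i\<close>. Exchanging \<open>f\<close> and \<open>g\<close>
  later gives equality.\<close>

lemma reduced_le:
  assumes "reduced f" "reduced g" "i \<in> {1..k}"
    and eq: "\<And>h t. height_ge G q (std_elem f) h t \<longleftrightarrow> height_ge G q (std_elem g) h t"
  shows "g i \<le> f i"
proof (cases "f i < e i")
  case True
  obtain j where j: "j \<in> {1..k}" "i \<le> j" "g j = f i" "g j < e j"
    using reduced_height_witness[OF assms(1,3) True eq] .
  obtain l where l: "l \<in> {1..k}" "j \<le> l" "f l = g j" "f l < e l"
    using reduced_height_witness[OF assms(2) j(1,4) eq[symmetric]] .
  have "i = l" using reduced_inj[OF assms(1,3) l(1)] l(3,4) True j(3) by simp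
  then show ?thesis using j l by simp
next
  case False
  then show ?thesis using reduced_le_e[OF assms(2,3)] by simp
qed

section \<open>Sequences and exponent functions\<close>

text \<open>An index missing from the sequence gets \<open>e i\<close>, the exponent of a zero
  component.\<close>

definition seq_fun :: "(nat \<times> nat) list \<Rightarrow> nat \<Rightarrow> nat" where
  "seq_fun s i = (case map_of s i of None \<Rightarrow> e i | Some f \<Rightarrow> f)"

text \<open>The relation between consecutive entries is transitive, so it extends to all pairs;
  \<open>e i \<ge> 1\<close> turns \<open>f \<le> e i - 1\<close> into
  \<open>f < e i\<close>.\<close>

lemma index_seqs_iff:
  "s \<in> index_seqs k e \<longleftrightarrow> (\<forall>(i, f) \<in> set s. i \<in> {1..k} \<and> f < e i) \<and>
     sorted_wrt (\<lambda>(i, f) (j, g). i < j \<and> f < g \<and> g + e i < f + e j) s"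
proof -
  have "transp (\<lambda>(i::nat, f) (j, g). i < j \<and> f < g \<and> g + e i < f + e j)"
    by (auto simp: transp_def)
  moreover have "f \<le> e i - 1 \<longleftrightarrow> f < e i" if "i \<in> {1..k}" for i f
    using e_pos[OF that] by auto
  ultimately show ?thesis
    unfolding index_seqs_def
    by (fastforce simp: sorted_wrt_iff_nth_Suc_transp case_prod_unfold)
qed

lemma index_seqs_sorted: "s \<in> index_seqs k e \<Longrightarrow> sorted_wrt (<) (map fst s)"
  unfolding index_seqs_iff sorted_wrt_map
  by (rule sorted_wrt_mono_rel[where P = "\<lambda>(i, f) (j, g). i < j \<and> f < g \<and> g + e i < f + e j"]) auto

lemma mem_set_iff_seq_fun:
  assumes "s \<in> index_seqs k e"
  shows "(i, f) \<in> set s \<longleftrightarrow> i \<in> {1..k} \<and> seq_fun s i = f \<and> f < e i"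
proof -
  have d: "distinct (map fst s)"
    using index_seqs_sorted[OF assms] strict_sorted_iff by blast
  have r: "(i, f) \<in> set s \<Longrightarrow> i \<in> {1..k} \<and> f < e i" for i f
    using assms unfolding index_seqs_iff by blast
  show ?thesis
    using r[of i f] map_of_eq_Some_iff[OF d, of i f]
    by (cases "map_of s i") (auto simp: seq_fun_def)
qed

text \<open>Two entries occur in the order of their indices, so (iv), extended to all pairs, gives
  both truncated inequalities.\<close>

lemma reduced_seq_fun:
  assumes s: "s \<in> index_seqs k e"
  shows "reduced (seq_fun s)"
proof -
  have lt: "seq_fun s i < seq_fun s j \<and> seq_fun s j + e i < seq_fun s i + e j"
    if ij: "i \<in> {1..k}" "j \<in> {1..k}" "i < j" "seq_fun s i < e i" "seq_fun s j < e j" for i j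
  proof -
    have "(i, seq_fun s i) \<in> set s" "(j, seq_fun s j) \<in> set s"
      using mem_set_iff_seq_fun[OF s] ij by auto
    then obtain a b where ab: "a < length s" "s ! a = (i, seq_fun s i)" "b < length s" "s ! b = (j, seq_fun s j)"
      by (auto simp: in_set_conv_nth)
    have w: "sorted_wrt (\<lambda>(i, f) (j, g). i < j \<and> f < g \<and> g + e i < f + e j) s"
      using s unfolding index_seqs_iff by blast
    have "a < b"
      using sorted_wrt_nth_less[OF w, of b a] ab ij(3) by (cases a b rule: linorder_cases) auto
    then show ?thesis using sorted_wrt_nth_less[OF w, of a b] ab by auto
  qed
  have "seq_fun s i \<le> e i" for i
  proof (cases "map_of s i")
    case (Some f)
    then show ?thesis using mem_set_iff_seq_fun[OF s, of i f] by (simp add: map_of_SomeD)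
  qed (simp add: seq_fun_def)
  moreover have "seq_fun s j < seq_fun s i + (e j - e i)"
    if "i \<in> {1..k}" "j \<in> {1..k}" "i \<noteq> j" "seq_fun s i < e i" "seq_fun s j < e j" for i j
    using lt[of i j] lt[of j i] that by (cases i j rule: linorder_cases) auto
  ultimately show ?thesis unfolding reduced_def by blast
qed

text \<open>Sorted by distinct first entries, a sequence is determined by its set of pairs, and that
  set by \<open>seq_fun\<close>.\<close>

lemma index_seqs_eqI:
  assumes "s \<in> index_seqs k e" "s' \<in> index_seqs k e"
    and "\<And>i. i \<in> {1..k} \<Longrightarrow> seq_fun s i = seq_fun s' i"
  shows "s = s'"
proof (rule map_sorted_distinct_set_unique)
  show eq: "set s = set s'"
    using mem_set_iff_seq_fun[OF assms(1)] mem_set_iff_seq_fun[OF assms(2)] assms(3) by auto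
  show "sorted (map fst s)" "distinct (map fst s)" "sorted (map fst s')" "distinct (map fst s')"
    using index_seqs_sorted assms(1,2) strict_sorted_iff by blast+
  then show "inj_on fst (set s \<union> set s')" using eq by (simp add: distinct_map)
qed

text \<open>As indices are distinct, each new term meets a zero component: there
  \<open>seq_fun\<close> changes from \<open>e i\<close> to \<open>f\<close>, and elsewhere nothing
  changes.\<close>

lemma rep_elem_eq_std_elem:
  assumes "\<And>i f. (i, f) \<in> set s \<Longrightarrow> i \<in> {1..k}" "distinct (map fst s)"
  shows "rep_elem G q eps s = std_elem (seq_fun s)"
  using assms
proof (induction s)
  case Nil
  show ?case
    by (rule ext) (simp add: one_apply std_elem_def seq_fun_def)
next
  case (Cons p s)
  obtain i f where p: "p = (i, f)" by (cases p)
  have i: "i \<in> {1..k}" and "map_of s i = None"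
    using Cons.prems p by (auto simp: map_of_eq_None_iff)
  then have sf: "seq_fun s i = e i" "seq_fun (p # s) = (seq_fun s)(i := f)"
    by (auto simp: seq_fun_def p)
  have IH: "rep_elem G q eps s = std_elem (seq_fun s)" using Cons by auto
  show ?case
  proof (rule carrier_eqI)
    show "rep_elem G q eps (p # s) \<in> carrier G"
      using eps_carrier[OF i] std_elem_carrier by (simp add: p IH)
    fix b assume b: "b \<in> coords"
    have "rep_elem G q eps (p # s) b = std_elem (seq_fun (p # s)) b"
      using b eps_outside[OF i, of b] sf(1)
      by (cases "fst b = i") (auto simp: p IH mult_apply pow_apply[OF eps_carrier[OF i]]
          std_elem_def sf(2)[unfolded p])
    then show "int q ^ e (fst b) dvd rep_elem G q eps (p # s) b - std_elem (seq_fun (p # s)) b"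
      by simp
  qed (rule std_elem_carrier)
qed

lemma rep_elem_index_seqs:
  assumes "s \<in> index_seqs k e"
  shows "rep_elem G q eps s = std_elem (seq_fun s)"
proof (rule rep_elem_eq_std_elem)
  show "distinct (map fst s)" using index_seqs_sorted[OF assms] strict_sorted_iff by blast
  show "i \<in> {1..k}" if "(i, f) \<in> set s" for i f
    using that assms mem_set_iff_seq_fun by blast
qed

text \<open>The sequence lists the nonzero components by increasing index. Only the elements are
  claimed equal, since \<open>f\<close> is arbitrary outside \<open>{1..k}\<close>.\<close>

lemma reduced_imp_index_seq:
  assumes f: "reduced f"
  obtains s where "s \<in> index_seqs k e" "std_elem (seq_fun s) = std_elem f"
proof -
  define l where "l = filter (\<lambda>i. f i < e i) [1..<Suc k]"
  define s where "s = map (\<lambda>i. (i, f i)) l"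
  have set_l: "i \<in> set l \<longleftrightarrow> i \<in> {1..k} \<and> f i < e i" for i
    unfolding l_def set_filter set_upt by auto
  have "sorted_wrt (\<lambda>i j. i < j \<and> f i < f j \<and> f j + e i < f i + e j) l"
  proof (rule sorted_wrt_mono_rel)
    show "sorted_wrt (<) l" unfolding l_def by (intro sorted_wrt_filter sorted_wrt_upt)
    fix i j assume "i \<in> set l" "j \<in> set l" "i < j"
    then have ij: "i \<in> {1..k}" "j \<in> {1..k}" "f i < e i" "f j < e j" "i < j"
      by (simp_all add: set_l)
    \<comment> \<open>As \<open>e i < e j\<close>, the truncated difference \<open>e i - e j\<close>
      is 0 and the second inequality becomes \<open>f i < f j\<close>.\<close>
    then have "f j < f i + (e j - e i)" "f i < f j + (e i - e j)" "e i < e j"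
      using reduced_less[OF f, of i j] reduced_less[OF f, of j i] e_mono by simp_all
    then show "i < j \<and> f i < f j \<and> f j + e i < f i + e j" using ij by linarith
  qed
  then have s: "s \<in> index_seqs k e"
    unfolding index_seqs_iff s_def by (auto simp: sorted_wrt_map set_l)
  have "seq_fun s i = f i" if i: "i \<in> {1..k}" for i
  proof (cases "f i < e i")
    case True
    then have "(i, f i) \<in> set s" using i by (auto simp: s_def set_l)
    then show ?thesis using mem_set_iff_seq_fun[OF s] by blast
  next
    case False
    then have "\<not> seq_fun s i < e i"
      using mem_set_iff_seq_fun[OF s, of i "seq_fun s i"] i by (auto simp: s_def set_l)
    then show ?thesis using False reduced_le_e[OF f i] reduced_le_e[OF reduced_seq_fun[OF s] i] by simp
  qed
  then have "std_elem (seq_fun s) = std_elem f"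
    using fst_coords by (auto simp: std_elem_def)
  then show thesis by (rule that[OF s])
qed

section \<open>Orbit representatives\<close>

text \<open>Existence combines normalisation, erasure and reading a reduced function as a sequence.
  For uniqueness, both representatives have the heights of \<open>x\<close>, and the one-sided
  comparison applies in both directions.\<close>

lemma orbit_representative:
  assumes x: "x \<in> carrier G"
  shows "\<exists>!s. s \<in> index_seqs k e \<and> orbit_rel G (rep_elem G q eps s) x"
proof (rule ex_ex1I)
  obtain f where f: "\<And>i. i \<in> {1..k} \<Longrightarrow> f i \<le> e i" "orbit_rel G x (std_elem f)"
    using orbit_rel_std_elem[OF x] by blast
  obtain g where g: "reduced g" "orbit_rel G (std_elem f) (std_elem g)"
    using orbit_rel_reduced[OF f(1)] by blast
  obtain s where "s \<in> index_seqs k e" "std_elem (seq_fun s) = std_elem g"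
    using reduced_imp_index_seq[OF g(1)] .
  then show "\<exists>s. s \<in> index_seqs k e \<and> orbit_rel G (rep_elem G q eps s) x"
    using orbit_rel_sym[OF x orbit_rel_trans[OF f(2) g(2)]] rep_elem_index_seqs[of s]
    by (intro exI[of _ s]) simp
next
  fix s s'
  assume "s \<in> index_seqs k e \<and> orbit_rel G (rep_elem G q eps s) x"
    "s' \<in> index_seqs k e \<and> orbit_rel G (rep_elem G q eps s') x"
  then have s: "s \<in> index_seqs k e" "s' \<in> index_seqs k e"
    and o: "orbit_rel G (std_elem (seq_fun s)) x" "orbit_rel G (std_elem (seq_fun s')) x"
    by (auto simp: rep_elem_index_seqs)
  have "height_ge G q (std_elem (seq_fun s)) h t \<longleftrightarrow> height_ge G q x h t"
    "height_ge G q (std_elem (seq_fun s')) h t \<longleftrightarrow> height_ge G q x h t" for h t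
    using height_ge_orbit_rel[OF std_elem_carrier o(1)] height_ge_orbit_rel[OF std_elem_carrier o(2)]
      height_ge_orbit_rel[OF x orbit_rel_sym[OF std_elem_carrier o(1)]]
      height_ge_orbit_rel[OF x orbit_rel_sym[OF std_elem_carrier o(2)]] by metis+
  then have eq: "height_ge G q (std_elem (seq_fun s)) h t
      \<longleftrightarrow> height_ge G q (std_elem (seq_fun s')) h t" for h t
    by simp
  show "s = s'"
    using reduced_le[OF reduced_seq_fun reduced_seq_fun _ eq, OF s]
      reduced_le[OF reduced_seq_fun reduced_seq_fun _ eq[symmetric], OF s(2,1)]
    by (intro index_seqs_eqI[OF s] antisym)
qed

end

theorem theorem2p1:
  fixes q k :: nat and e n :: "nat \<Rightarrow> nat" and eps :: "nat \<Rightarrow> (nat \<times> nat \<Rightarrow> int)"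
  assumes "Factorial_Ring.prime q"
    and "\<forall>i \<in> {1..k}. 1 \<le> e i \<and> 0 < n i"
    and "\<forall>i \<in> {1..k}. \<forall>i' \<in> {1..k}. i < i' \<longrightarrow> e i < e i'"
    and "\<forall>i \<in> {1..k}. eps i \<in> summand q k e n i"
    and "\<forall>i \<in> {1..k}. \<forall>a \<in> summand q k e n i. eps i \<noteq> a [^]\<^bsub>abgrp q k e n\<^esub> q"
  shows "\<forall>x \<in> carrier (abgrp q k e n).
           \<exists>!s. s \<in> index_seqs k e \<and>
                (\<exists>\<phi> \<in> iso (abgrp q k e n) (abgrp q k e n).
                   \<phi> (rep_elem (abgrp q k e n) q eps s) = x)"
proof -
  interpret based_abelian_q_group q k e n eps
    using assms by unfold_locales blast+
  show ?thesis
    using orbit_representative unfolding orbit_rel_def by blast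
qed

end
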